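(* Let $m=(m_0,m_1,\dots)$ be a fixed bounded sequence of integers with $m_k\ge 2$ for all $k$, and let $G_m$ be the corresponding bounded Vilenkin group. (a) Let $0<p<1$. Then there exists a constant $c_p$, depending only on $p$ (with $m$ fixed), such that for every martingale $f\in H_p(G_m)$ and every positive integer $n$, $$\left|\widehat f(n)\right|\le c_p\, n^{1/p-1}\,\|f\|_{H_p}.$$ (b) Let $0<p<1$ and let $\Phi$ be any nondecreasing, nonnegative function on the positive integers satisfying $$\limsup_{n\to\infty}\frac{n^{1/p-1}}{\Phi(n)}=\infty .$$ Then there exists a martingale $f_0\in H_p(G_m)$ such that $$\limsup_{n\to\infty}\frac{|\widehat f_0(n)|}{\Phi(n)}=\infty .$$
   Context: Let $P_+$ denote the set of positive integers and $P=P_+\cup\{0\}$. Let $m=(m_0,m_1,\dots)$ be a sequence of integers with $m_k\ge 2$ and $\sup_k m_k<\infty$. Let $Z_{m_k}=\{0,1,\dots,m_k-1\}$ be the additive group of integers modulo $m_k$. The bounded Vilenkin group $G_m$ is the complete direct product $\prod_{k\in P} Z_{m_k}$ with the product of the discrete topologies. Its elements are sequences $x=(x_0,x_1,\dots)$ with $x_k\in Z_{m_k}$. The measure $\mu$ is the product of the uniform probability measures $\mu_k(\{j\})=1/m_k$ on $Z_{m_k}$; it is the Haar measure with $\mu(G_m)=1$. Intervals: $I_0(x)=G_m$ and $I_n(x)=\{y\in G_m: y_0=x_0,\dots,y_{n-1}=x_{n-1}\}$ for $n\in P_+$. Let $\mathcal F_n$ be the $\sigma$-algebra generated by the intervals $\{I_n(x):x\in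 G_m\}$, and let $E_n$ be the conditional expectation operator relative to $\mathcal F_n$ (with respect to $\mu$). Generalized number system: $M_0=1$, $M_{k+1}=m_kM_k$. Every $n\in P$ is uniquely $n=\sum_{k=0}^\infty n_kM_k$ with $n_k\in Z_{m_k}$, only finitely many $n_k$ being nonzero. Vilenkin system: $r_k(x)=\exp(2\pi i x_k/m_k)$ and $\psi_n(x)=\prod_{k=0}^\infty r_k(x)^{n_k}$ for $n\in P$, $x\in G_m$. Martingales: a martingale is a sequence $f=(f^{(n)}:n\in P)$ of functions $f^{(n)}\in L_1(G_m)$ such that $f^{(n)}$ is $\mathcal F_n$-measurable for all $n\in P$ and $E_nf^{(k)}=f^{(n)}$ for all $n\le k$. Its maximal function is $f^*=\sup_{n\in P}|f^{(n)}|$. For $0<p<\infty$, let $\|g\|_p=\left(\int_{G_m}|g|^p\,d\mu\right)^{1/p}$. The Hardy martingale space $H_p(G_m)$ consists of all martingales $f$ with $\|f\|_{H_p}:=\|f^*\|_p<\infty$. Vilenkin-Fourier coefficients of a martingale $f=(f^{(n)}:n\in P)$: $$\widehat f(i)=\lim_{k\to\infty}\int_{G_m}f^{(k)}(x)\,\overline{\psi_i(x)}\,d\mu(x),\qquad i\in P.$$ Convention for quotients with denominator $\Phi(n)=0$: $a/0=+\infty$ for $a>0$ and $0/0=0$. *)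

theory Defs
  imports "HOL-Probability.Probability"
begin

subsection \<open>The Vilenkin group as a probability space\<close>

definition vilenkin :: "(nat \<Rightarrow> nat) \<Rightarrow> (nat \<Rightarrow> nat) measure" where
  "vilenkin m = (\<Pi>\<^sub>M k\<in>UNIV. uniform_count_measure {..<m k})"

definition vinterval :: "(nat \<Rightarrow> nat) \<Rightarrow> nat \<Rightarrow> (nat \<Rightarrow> nat) \<Rightarrow> (nat \<Rightarrow> nat) set" where
  "vinterval m n x = {y \<in> space (vilenkin m). \<forall>i<n. y i = x i}"

definition vfiltration :: "(nat \<Rightarrow> nat) \<Rightarrow> nat \<Rightarrow> (nat \<Rightarrow> nat) measure" where
  "vfiltration m n =
     sigma (space (vilenkin m)) (vinterval m n ` space (vilenkin m))"


subsection \<open>The generalized number system and the Vilenkin system\<close>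

primrec vM :: "(nat \<Rightarrow> nat) \<Rightarrow> nat \<Rightarrow> nat" where
  "vM m 0 = 1"
| "vM m (Suc k) = m k * vM m k"

definition vdigit :: "(nat \<Rightarrow> nat) \<Rightarrow> nat \<Rightarrow> nat \<Rightarrow> nat" where
  "vdigit m n k = n div vM m k mod m k"

definition rademacher :: "(nat \<Rightarrow> nat) \<Rightarrow> nat \<Rightarrow> (nat \<Rightarrow> nat) \<Rightarrow> complex" where
  "rademacher m k x = exp (2 * of_real pi * \<i> * of_nat (x k) / of_nat (m k))"

definition vchar :: "(nat \<Rightarrow> nat) \<Rightarrow> nat \<Rightarrow> (nat \<Rightarrow> nat) \<Rightarrow> complex" where
  "vchar m n x = (\<Prod>k. rademacher m k x ^ vdigit m n k)"

text \<open>
  The closed form for the digits yields the unique finitely supported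
  expansion of \<open>n\<close> in the basis \<open>vM m\<close>.
\<close>

lemma vM_gt:
  assumes "\<forall>k. 2 \<le> m k"
  shows "k < vM m k"
proof (induction k)
  case (Suc k)
  have "2 * vM m k \<le> m k * vM m k" using assms by (intro mult_right_mono) auto
  moreover have "vM m (Suc k) = m k * vM m k" by simp
  ultimately show ?case using Suc by linarith
qed simp

lemma vdigit_less: "\<forall>k. 2 \<le> m k \<Longrightarrow> vdigit m n k < m k"
  unfolding vdigit_def by (metis mod_less_divisor less_le_trans pos2)

lemma finite_vdigit:
  assumes "\<forall>k. 2 \<le> m k"
  shows "finite {k. vdigit m n k \<noteq> 0}"
proof (rule finite_subset)
  have "vdigit m n k = 0" if "n \<le> k" for k
    using vM_gt[OF assms, of k] that by (simp add: vdigit_def)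
  then show "{k. vdigit m n k \<noteq> 0} \<subseteq> {..<n}"
    by (force simp: not_less[symmetric])
qed simp

lemma vdigit_partial_sum: "n mod vM m K = (\<Sum>k<K. vdigit m n k * vM m k)"
proof (induction K)
  case (Suc K)
  have "n mod vM m (Suc K) = n mod (vM m K * m K)" by (simp add: mult.commute)
  also have "\<dots> = vM m K * (n div vM m K mod m K) + n mod vM m K"
    by (simp add: mod_mult2_eq)
  finally show ?case using Suc by (simp add: vdigit_def mult.commute)
qed simp

lemma vdigit_sum:
  assumes "\<forall>k. 2 \<le> m k"
  shows "n = (\<Sum>k | vdigit m n k \<noteq> 0. vdigit m n k * vM m k)"
proof -
  have "vdigit m n k = 0" if "n \<le> k" for k
    using vM_gt[OF assms, of k] that by (simp add: vdigit_def)
  then have "(\<Sum>k<n. vdigit m n k * vM m k) = (\<Sum>k | vdigit m n k \<noteq> 0. vdigit m n k * vM m k)"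
    by (intro sum.mono_neutral_right) (force simp: not_less[symmetric])+
  then show ?thesis
    using vdigit_partial_sum[of n m n] vM_gt[OF assms, of n] by simp
qed

lemma digit_sum_less:
  assumes "\<forall>k. d k < m k"
  shows "(\<Sum>k<K. d k * vM m k) < vM m K"
proof (induction K)
  case (Suc K)
  have "Suc (d K) * vM m K \<le> m K * vM m K"
    using assms by (intro mult_right_mono) (auto simp: Suc_le_eq)
  then show ?case using Suc by simp
qed simp

lemma vdigit_unique:
  assumes "\<forall>k. 2 \<le> m k" and d: "\<forall>k. d k < m k" and fin: "finite {k. d k \<noteq> 0}"
    and n: "n = (\<Sum>k | d k \<noteq> 0. d k * vM m k)"
  shows "d = vdigit m n"
proof
  fix j
  obtain K where K: "\<forall>k\<in>{k. d k \<noteq> 0}. k < K" "j < K"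
    using fin by (metis finite_nat_set_iff_bounded finite_insert insert_iff)
  have nK: "n = (\<Sum>k<K. d k * vM m k)"
    unfolding n using K by (intro sum.mono_neutral_left) auto
  have "\<exists>c. (\<Sum>k<j + i. d k * vM m k) = (\<Sum>k<j. d k * vM m k) + c * vM m j
           \<and> (i > 0 \<longrightarrow> c mod m j = d j)" for i
  proof (induction i)
    case (Suc i)
    have dvd: "i > 0 \<Longrightarrow> m j * vM m j dvd vM m (j + i)"
    proof (induction i)
      case (Suc i)
      then show ?case by (cases "i = 0") auto
    qed simp
    obtain c where c: "(\<Sum>k<j + i. d k * vM m k) = (\<Sum>k<j. d k * vM m k) + c * vM m j"
      "i > 0 \<longrightarrow> c mod m j = d j" using Suc by blast
    show ?case
    proof (cases "i = 0")
      case True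
      then show ?thesis using d by (intro exI[of _ "d j"]) simp
    next
      case False
      then obtain q where q: "vM m (j + i) = m j * vM m j * q" using dvd by blast
      have "(c + m j * (q * d (j + i))) mod m j = d j" using c(2) False by simp
      moreover have "(\<Sum>k<j + Suc i. d k * vM m k) =
          (\<Sum>k<j. d k * vM m k) + (c + m j * (q * d (j + i))) * vM m j"
        using c(1) q by (simp add: algebra_simps)
      ultimately show ?thesis by blast
    qed
  qed (auto intro: exI[of _ 0])
  from this[of "K - j"] K(2) obtain c
    where c: "n = (\<Sum>k<j. d k * vM m k) + c * vM m j" "c mod m j = d j"
    unfolding nK by auto
  have "n div vM m j = c"
    using c(1) digit_sum_less[OF d, of j] by simp
  then show "d j = vdigit m n j" using c(2) by (simp add: vdigit_def)
qed


subsection \<open>Martingales and Hardy spaces\<close>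

text \<open>
  The library's conditional expectation is real-valued; the martingales here
  are complex-valued, so it is applied to real and imaginary parts.
\<close>

definition complex_cond_exp ::
    "'a measure \<Rightarrow> 'a measure \<Rightarrow> ('a \<Rightarrow> complex) \<Rightarrow> 'a \<Rightarrow> complex" where
  "complex_cond_exp M F f x =
     Complex (real_cond_exp M F (\<lambda>y. Re (f y)) x) (real_cond_exp M F (\<lambda>y. Im (f y)) x)"

definition vmartingale :: "(nat \<Rightarrow> nat) \<Rightarrow> (nat \<Rightarrow> (nat \<Rightarrow> nat) \<Rightarrow> complex) \<Rightarrow> bool" where
  "vmartingale m f \<longleftrightarrow>
     (\<forall>n. integrable (vilenkin m) (f n)) \<and>
     (\<forall>n. f n \<in> borel_measurable (vfiltration m n)) \<and>
     (\<forall>n k. n \<le> k \<longrightarrow>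
        (AE x in vilenkin m. complex_cond_exp (vilenkin m) (vfiltration m n) (f k) x = f n x))"

definition maximal_fun :: "(nat \<Rightarrow> 'a \<Rightarrow> complex) \<Rightarrow> 'a \<Rightarrow> ennreal" where
  "maximal_fun f x = (SUP n. ennreal (cmod (f n x)))"

text \<open>Powers of extended nonnegative reals, meant for exponents \<open>p > 0\<close> only.\<close>

definition ennreal_pow :: "ennreal \<Rightarrow> real \<Rightarrow> ennreal" where
  "ennreal_pow a p = (if a = \<top> then \<top> else ennreal (enn2real a powr p))"

definition Lp_qnorm :: "'a measure \<Rightarrow> real \<Rightarrow> ('a \<Rightarrow> ennreal) \<Rightarrow> ennreal" where
  "Lp_qnorm M p g = ennreal_pow (\<integral>\<^sup>+ x. ennreal_pow (g x) p \<partial>M) (1 / p)"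

definition Hp_norm :: "(nat \<Rightarrow> nat) \<Rightarrow> real \<Rightarrow> (nat \<Rightarrow> (nat \<Rightarrow> nat) \<Rightarrow> complex) \<Rightarrow> ennreal" where
  "Hp_norm m p f = Lp_qnorm (vilenkin m) p (maximal_fun f)"

definition Hp :: "(nat \<Rightarrow> nat) \<Rightarrow> real \<Rightarrow> (nat \<Rightarrow> (nat \<Rightarrow> nat) \<Rightarrow> complex) set" where
  "Hp m p = {f. vmartingale m f \<and> Hp_norm m p f < \<infinity>}"

definition vfourier :: "(nat \<Rightarrow> nat) \<Rightarrow> (nat \<Rightarrow> (nat \<Rightarrow> nat) \<Rightarrow> complex) \<Rightarrow> nat \<Rightarrow> complex" where
  "vfourier m f i = lim (\<lambda>k. \<integral>x. f k x * cnj (vchar m i x) \<partial>vilenkin m)"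

end

theory Submission
  imports Defs
begin

text \<open>
  (a) If \<open>f \<in> H\<^sub>p\<close>, then its \<open>K\<close>-th term \<open>g\<close> is constant on intervals of measure \<open>1 / M\<^sub>K\<close>, so
  \<open>\<bar>g\<bar> \<le> M\<^sub>K powr (1/p) * \<parallel>f\<parallel>\<close> pointwise. Writing \<open>\<bar>g\<bar> = \<bar>g\<bar> powr (1 - p) * \<bar>g\<bar> powr p\<close> gives the
  \<open>L\<^sub>1\<close> bound \<open>M\<^sub>K powr (1/p - 1) * \<parallel>f\<parallel>\<close>. If \<open>M\<^sub>N \<le> n < M\<^sub>N\<^sub>+\<^sub>1\<close> and \<open>K = N + 1\<close>, the \<open>n\<close>-th
  coefficient is an integral of \<open>g\<close> against a unimodular function, and \<open>M\<^sub>K = O(n)\<close>.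

  (b) With the Dirichlet kernels \<open>D\<^sub>j\<close>, equal to \<open>M\<^sub>j\<close> on \<open>I\<^sub>j(0)\<close> and to \<open>0\<close> elsewhere, take the
  martingale with differences \<open>c\<^sub>j (D\<^sub>j\<^sub>+\<^sub>1 - D\<^sub>j)\<close>. Its coefficient at \<open>M\<^sub>j\<close> is \<open>c\<^sub>j\<close>, and since
  \<open>t \<mapsto> t powr p\<close> is subadditive it lies in \<open>H\<^sub>p\<close> as soon as
  \<open>c\<^sub>j = r\<^sub>j * M\<^sub>j powr (1/p - 1)\<close> with \<open>\<Sum> r\<^sub>j powr p < \<infinity>\<close>. Monotonicity of \<open>\<Phi>\<close> and boundedness of
  \<open>m\<close> make \<open>M\<^sub>j powr (1/p - 1) / \<Phi>(M\<^sub>j)\<close> unbounded, so \<open>r\<close> can be a geometric sequence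
  supported on a sparse set.
\<close>


subsection \<open>Powers, roots of unity and upper limits\<close>

text \<open>Split \<open>(a + b) powr p\<close> as
  \<open>a * (a + b) powr (p - 1) + b * (a + b) powr (p - 1)\<close>; the exponent
  \<open>p - 1\<close> is not positive, so shrinking the base to \<open>a\<close> or
  \<open>b\<close> only increases each term.\<close>

lemma powr_add_le:
  fixes a b p :: real
  assumes "0 \<le> a" "0 \<le> b" "0 < p" "p \<le> 1"
  shows "(a + b) powr p \<le> a powr p + b powr p"
proof (cases "a = 0 \<or> b = 0")
  case False
  then have ab: "a > 0" "b > 0" using assms by auto
  have "(a + b) powr p = (a + b) powr 1 * (a + b) powr (p - 1)"
    unfolding powr_add[symmetric] by simp
  also have "\<dots> = a * (a + b) powr (p - 1) + b * (a + b) powr (p - 1)"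
    using ab by (simp add: distrib_right)
  also have "\<dots> \<le> a * a powr (p - 1) + b * b powr (p - 1)"
    using ab assms by (intro add_mono mult_left_mono powr_mono2') auto
  also have "\<dots> = a powr p + b powr p"
    using ab by (simp add: powr_diff)
  finally show ?thesis .
qed (use assms in auto)

lemma powr_sum_le:
  fixes a :: "'a \<Rightarrow> real" and p :: real
  assumes "finite S" "\<And>i. i \<in> S \<Longrightarrow> 0 \<le> a i" "0 < p" "p \<le> 1"
  shows "(\<Sum>i\<in>S. a i) powr p \<le> (\<Sum>i\<in>S. a i powr p)"
  using assms(1,2)
proof (induction S rule: finite_induct)
  case (insert x S)
  have "(a x + sum a S) powr p \<le> a x powr p + sum a S powr p"
    using insert assms by (intro powr_add_le sum_nonneg) auto
  with insert show ?case by simp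
qed (use assms in simp)

text \<open>A geometric sum with ratio \<open>w\<close>, where \<open>w ^ k = 1\<close>. It vanishes
  because \<open>w = 1\<close> would make \<open>k\<close> a divisor of 1.\<close>

lemma sum_roots_of_unity:
  assumes "2 \<le> (k::nat)"
  shows "(\<Sum>a<k. exp (2 * of_real pi * \<i> * of_nat a / of_nat k :: complex)) = 0"
proof -
  define w where "w = exp (2 * of_real pi * \<i> / of_nat k)"
  have "w ^ k = 1"
    using assms by (simp add: w_def exp_of_nat_mult[symmetric])
  moreover have "w \<noteq> 1"
  proof
    assume "w = 1"
    then obtain n :: int where n: "Im (2 * of_real pi * \<i> / of_nat k) = of_int (2 * n) * pi"
      unfolding w_def exp_eq_1 by blast
    have "Im (2 * of_real pi * \<i> / of_nat k) = 2 * pi / real k"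
      by simp
    with n have "real_of_int n * real k = 1" using assms by (simp add: field_simps)
    then have "n * int k = 1" by (metis of_int_eq_1_iff of_int_mult of_int_of_nat_eq)
    then have "int k dvd 1" by (metis dvd_triv_right)
    then show False using assms by simp
  qed
  ultimately have "(\<Sum>a<k. w ^ a) = 0" by (simp add: geometric_sum)
  moreover have "exp (2 * of_real pi * \<i> * of_nat a / of_nat k) = w ^ a" for a
    by (simp add: w_def exp_of_nat_mult[symmetric] algebra_simps)
  ultimately show ?thesis by simp
qed

section \<open>Extended nonnegative reals: powers, quotients, infinite upper limits\<close>

lemma ennreal_pow_mono: "0 \<le> p \<Longrightarrow> a \<le> b \<Longrightarrow> ennreal_pow a p \<le> ennreal_pow b p"
  unfolding ennreal_pow_def
  by (auto simp: top_unique less_top intro!: ennreal_leI powr_mono2 enn2real_mono)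

lemma ennreal_pow_ennreal: "0 \<le> a \<Longrightarrow> ennreal_pow (ennreal a) p = ennreal (a powr p)"
  by (simp add: ennreal_pow_def)

text \<open>Clears the denominator uniformly: for \<open>v = 0\<close> the quotient is
  \<open>\<top>\<close> because \<open>u\<close> is positive, and both sides are true. Zeros of
  \<Phi> thus need no separate treatment later.\<close>

lemma ennreal_less_divide_iff:
  assumes "0 \<le> C" "0 < u" "0 \<le> v"
  shows "ennreal C < ennreal u / ennreal v \<longleftrightarrow> C * v < u"
proof (cases "v = 0")
  case False
  then have "ennreal u / ennreal v = ennreal (u / v)"
    using assms by (simp add: divide_ennreal)
  then show ?thesis using False assms by (simp add: ennreal_less_iff field_simps)
qed (use assms in \<open>simp add: ennreal_divide_zero\<close>)

text \<open>Serves to unpack the hypothesis of (b) and to establish its conclusion. In the converse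
  direction, a finite tail supremum would be a real \<open>C\<close> exceeded by one of its own
  terms.\<close>

lemma limsup_eq_top_iff:
  fixes u :: "nat \<Rightarrow> ennreal"
  shows "limsup u = \<top> \<longleftrightarrow> (\<forall>C\<ge>0. \<forall>N. \<exists>n\<ge>N. ennreal C < u n)"
proof safe
  fix C :: real and N :: nat
  assume "limsup u = \<top>" "0 \<le> C"
  then have "ennreal C < limsup u" by simp
  then have "ennreal C < (SUP n\<in>{N..}. u n)"
    unfolding limsup_INF_SUP by (rule less_le_trans) (auto intro: INF_lower)
  then show "\<exists>n\<ge>N. ennreal C < u n" by (auto simp: less_SUP_iff)
next
  assume *: "\<forall>C\<ge>0. \<forall>N. \<exists>n\<ge>N. ennreal C < u n"
  have "(SUP n\<in>{N..}. u n) = \<top>" for N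
  proof (rule ccontr)
    assume "(SUP n\<in>{N..}. u n) \<noteq> \<top>"
    then obtain C where C: "C \<ge> 0" "(SUP n\<in>{N..}. u n) = ennreal C"
      by (metis ennreal_cases)
    with * obtain n where "n \<ge> N" "ennreal C < u n" by blast
    moreover have "u n \<le> ennreal C" unfolding C(2)[symmetric] using \<open>n \<ge> N\<close> by (intro SUP_upper) auto
    ultimately show False by simp
  qed
  then show "limsup u = \<top>" unfolding limsup_INF_SUP by simp
qed


subsection \<open>Intervals, filtration and characters\<close>

locale bounded_vilenkin =
  fixes m :: "nat \<Rightarrow> nat"
  assumes ge2: "\<forall>k. 2 \<le> m k" and bdd: "bdd_above (range m)"
begin

section \<open>The probability space and the measure of its intervals\<close>

lemma m_pos: "0 < m k"
  using ge2 by (meson less_le_trans pos2)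

lemma prob_space_factor: "prob_space (uniform_count_measure {..<m k})"
  using m_pos[of k] by (intro prob_space_uniform_count_measure) auto

sublocale prob_space "vilenkin m"
  unfolding vilenkin_def by (intro prob_space_PiM prob_space_factor)

lemma mem_space: "x \<in> space (vilenkin m) \<longleftrightarrow> (\<forall>k. x k < m k)"
  by (auto simp: vilenkin_def space_PiM space_uniform_count_measure PiE_iff)

lemma zero_in_space: "(\<lambda>_. 0) \<in> space (vilenkin m)"
  by (simp add: mem_space m_pos)

text \<open>The set is the embedding of a finite box into the product, so its measure is a finite
  product of uniform measures. Intervals, and intervals with one further coordinate fixed, are both
  of this kind.\<close>

lemma cylinder:
  assumes "finite J" "\<And>i. i \<in> J \<Longrightarrow> B i \<subseteq> {..<m i}"
  shows "{y \<in> space (vilenkin m). \<forall>i\<in>J. y i \<in> B i} \<in> sets (vilenkin m)" (is "?C \<in> _")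
    and "measure (vilenkin m) {y \<in> space (vilenkin m). \<forall>i\<in>J. y i \<in> B i}
      = (\<Prod>i\<in>J. real (card (B i)) / real (m i))"
proof -
  let ?U = "\<lambda>k. uniform_count_measure {..<m k}"
  interpret product_prob_space ?U UNIV
    by (intro product_prob_spaceI prob_space_factor)
  have B: "B i \<in> sets (?U i)" if "i \<in> J" for i
    using assms(2)[OF that] by (simp add: sets_uniform_count_measure)
  have C: "?C = prod_emb UNIV ?U J (Pi\<^sub>E J B)"
    by (auto simp: prod_emb_def vilenkin_def space_PiM PiE_iff restrict_def extensional_def)
  show "?C \<in> sets (vilenkin m)"
    unfolding C unfolding vilenkin_def using assms(1) B by (intro sets_PiM_I) auto
  have "measure (vilenkin m) ?C = (\<Prod>i\<in>J. measure (?U i) (B i))"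
    unfolding C unfolding vilenkin_def using assms(1) B by (intro measure_PiM_emb) auto
  also have "\<dots> = (\<Prod>i\<in>J. real (card (B i)) / real (m i))"
    using assms(2) by (intro prod.cong refl) (simp add: measure_uniform_count_measure)
  finally show "measure (vilenkin m) ?C = (\<Prod>i\<in>J. real (card (B i)) / real (m i))" .
qed

lemma vM_eq_prod: "vM m n = (\<Prod>i<n. m i)"
  by (induction n) simp_all

lemma vM_pos: "0 < vM m n"
  using vM_gt[OF ge2, of n] by linarith

lemma vinterval_eq_cylinder:
  "vinterval m n x = {y \<in> space (vilenkin m). \<forall>i\<in>{..<n}. y i \<in> {x i}}"
  by (auto simp: vinterval_def)

lemma sets_vinterval: "x \<in> space (vilenkin m) \<Longrightarrow> vinterval m n x \<in> sets (vilenkin m)"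
  unfolding vinterval_eq_cylinder by (intro cylinder) (auto simp: mem_space)

lemma measure_vinterval:
  assumes "x \<in> space (vilenkin m)"
  shows "measure (vilenkin m) (vinterval m n x) = 1 / real (vM m n)"
proof -
  have "measure (vilenkin m) (vinterval m n x) = (\<Prod>i<n. 1 / real (m i))"
    unfolding vinterval_eq_cylinder using assms by (subst cylinder) (auto simp: mem_space)
  then show ?thesis by (simp add: vM_eq_prod prod_dividef)
qed

section \<open>The filtration: measurable means depending on the first \<open>n\<close>
  coordinates\<close>

lemma space_vfiltration: "space (vfiltration m n) = space (vilenkin m)"
  unfolding vfiltration_def by (rule space_measure_of) (auto simp: vinterval_def)

lemma sets_vfiltration:
  "sets (vfiltration m n) = sigma_sets (space (vilenkin m)) (vinterval m n ` space (vilenkin m))"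
  unfolding vfiltration_def by (rule sets_measure_of) (auto simp: vinterval_def)

lemma subalgebra_vfiltration: "subalgebra (vilenkin m) (vfiltration m n)"
  unfolding subalgebra_def space_vfiltration sets_vfiltration
  by (intro conjI refl sets.sigma_sets_subset) (auto intro: sets_vinterval)

lemma finite_measure_subalgebra_vfiltration:
  "finite_measure_subalgebra (vilenkin m) (vfiltration m n)"
  by (intro finite_measure_subalgebra.intro finite_measure_axioms
      finite_measure_subalgebra_axioms.intro subalgebra_vfiltration)

text \<open>A generating interval cannot separate points that share their first \<open>n\<close>
  coordinates, and this survives complements and countable unions.\<close>

lemma vfiltration_saturated:
  assumes "A \<in> sets (vfiltration m n)" "x \<in> space (vilenkin m)" "y \<in> space (vilenkin m)"
    and "\<forall>i<n. x i = y i"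
  shows "x \<in> A \<longleftrightarrow> y \<in> A"
  using assms(1) unfolding sets_vfiltration
proof (induction rule: sigma_sets.induct)
  case (Basic a)
  then show ?case using assms by (auto simp: vinterval_def)
qed (use assms in auto)

lemma measurable_vfiltrationI:
  fixes g :: "(nat \<Rightarrow> nat) \<Rightarrow> 'b::topological_space"
  assumes "\<And>x y. \<lbrakk>x \<in> space (vilenkin m); y \<in> space (vilenkin m); \<forall>i<n. x i = y i\<rbrakk> \<Longrightarrow> g x = g y"
  shows "g \<in> borel_measurable (vfiltration m n)"
proof (rule measurableI)
  fix S
  let ?X = "space (vilenkin m)"
  let ?I = "vinterval m n ` (g -` S \<inter> ?X)"
  \<comment> \<open>An interval is determined by the first \<open>n\<close> coordinates of its
    centre, which range over a finite product. Every preimage under \<open>g\<close> is therefore a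
    finite union of intervals.\<close>
  have fin: "finite (vinterval m n ` ?X)"
  proof (rule finite_surj)
    show "finite (PiE {..<n} (\<lambda>i. {..<m i}))" by (intro finite_PiE) auto
    have "vinterval m n x = vinterval m n (restrict x {..<n})" for x
      by (auto simp: vinterval_def)
    moreover have "restrict x {..<n} \<in> PiE {..<n} (\<lambda>i. {..<m i})" if "x \<in> ?X" for x
      using that by (auto simp: mem_space)
    ultimately show "vinterval m n ` ?X \<subseteq> vinterval m n ` (PiE {..<n} (\<lambda>i. {..<m i}))"
      by blast
  qed
  have "g -` S \<inter> ?X = \<Union>?I"
  proof (intro equalityI subsetI)
    fix x assume x: "x \<in> g -` S \<inter> ?X"
    then have "x \<in> vinterval m n x" by (auto simp: vinterval_def)
    with x show "x \<in> \<Union>?I" by blast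
  next
    fix y assume "y \<in> \<Union>?I"
    then obtain x where "g x \<in> S" "x \<in> ?X" "y \<in> ?X" "\<forall>i<n. y i = x i"
      by (auto simp: vinterval_def)
    then show "y \<in> g -` S \<inter> ?X" using assms[of y x] by auto
  qed
  moreover have "\<Union>?I \<in> sets (vfiltration m n)"
  proof (rule sets.finite_Union)
    show "finite ?I" using fin by (rule finite_subset[rotated]) auto
    show "?I \<subseteq> sets (vfiltration m n)"
      unfolding sets_vfiltration by (auto intro: sigma_sets.Basic)
  qed
  ultimately show "g -` S \<inter> space (vfiltration m n) \<in> sets (vfiltration m n)"
    by (simp add: space_vfiltration)
qed simp

text \<open>Points are closed in a T1 space, so the level set of \<open>g\<close> through
  \<open>x\<close> is measurable, hence saturated, hence contains \<open>y\<close>.\<close>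

lemma vfiltration_measurable_const:
  fixes g :: "(nat \<Rightarrow> nat) \<Rightarrow> 'b::t1_space"
  assumes g: "g \<in> borel_measurable (vfiltration m n)"
    and xy: "x \<in> space (vilenkin m)" "y \<in> space (vilenkin m)" "\<forall>i<n. x i = y i"
  shows "g x = g y"
proof -
  have "g -` {g x} \<inter> space (vfiltration m n) \<in> sets (vfiltration m n)"
    using g by (rule measurable_sets) simp
  from vfiltration_saturated[OF this xy] show ?thesis
    using xy by (auto simp: space_vfiltration)
qed

lemma vfiltration_measurable:
  "g \<in> borel_measurable (vfiltration m n) \<Longrightarrow> g \<in> borel_measurable (vilenkin m)"
  using subalgebra_vfiltration by (rule measurable_from_subalg)

section \<open>Growth of the number base and the characters\<close>

lemma vM_less_Suc: "vM m j < vM m (Suc j)"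
proof -
  have "2 * vM m j \<le> m j * vM m j" using ge2 by (intro mult_right_mono) auto
  then show ?thesis using vM_pos[of j] by simp
qed

lemma vM_mono: "k \<le> l \<Longrightarrow> vM m k \<le> vM m l"
  by (rule lift_Suc_mono_le[of "vM m"]) (use vM_less_Suc less_imp_le in blast)+

text \<open>All digits of \<open>n\<close> from position \<open>K\<close> on vanish, so the
  remaining factors of the infinite product are 1.\<close>

lemma vchar_eq_prod:
  assumes "n < vM m K"
  shows "vchar m n x = (\<Prod>k<K. rademacher m k x ^ vdigit m n k)"
  unfolding vchar_def
proof (rule prodinf_finite)
  fix k assume "k \<notin> {..<K}"
  then have "n < vM m k" using assms vM_mono[of K k] by simp
  then show "rademacher m k x ^ vdigit m n k = 1" by (simp add: vdigit_def)
qed simp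

lemma norm_vchar: "cmod (vchar m n x) = 1"
proof -
  have "cmod (rademacher m k x) = 1" for k
    by (simp add: rademacher_def norm_exp_eq_Re)
  then show ?thesis
    by (simp add: vchar_eq_prod[OF vM_gt[OF ge2, of n]] prod_norm[symmetric] norm_power)
qed

lemma vchar_measurable:
  assumes "n < vM m K"
  shows "vchar m n \<in> borel_measurable (vfiltration m K)"
proof (rule measurable_vfiltrationI)
  fix x y :: "nat \<Rightarrow> nat"
  assume "\<forall>i<K. x i = y i"
  then have "rademacher m k x = rademacher m k y" if "k < K" for k
    using that by (simp only: rademacher_def)
  then show "vchar m n x = vchar m n y"
    unfolding vchar_eq_prod[OF assms] by (intro prod.cong refl) simp
qed

lemma vdigit_vM: "vdigit m (vM m j) k = (if k = j then 1 else 0)"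
proof -
  have dvd: "vM m k dvd vM m j" if "k \<le> j" for k j
    using that by (induction rule: dec_induct) auto
  consider "k < j" | "k = j" | "k > j" by linarith
  then show ?thesis
  proof cases
    case 1
    with dvd[of "Suc k" j] obtain c where "vM m j = m k * vM m k * c" by (auto elim: dvdE)
    then show ?thesis using 1 vM_pos[of k] by (simp add: vdigit_def)
  next
    case 2
    then show ?thesis using vM_pos[of k] spec[OF ge2, of k] by (simp add: vdigit_def)
  next
    case 3
    then have "vM m j < vM m k" by (rule lift_Suc_mono_less[of "vM m", OF vM_less_Suc])
    then show ?thesis using 3 by (simp add: vdigit_def)
  qed
qed

lemma vchar_vM: "vchar m (vM m j) = rademacher m j"
proof
  fix x
  have "(\<Prod>k<j. rademacher m k x ^ vdigit m (vM m j) k) = 1"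
    by (intro prod.neutral) (simp add: vdigit_vM)
  then show "vchar m (vM m j) x = rademacher m j x"
    unfolding vchar_eq_prod[OF vM_less_Suc] prod.lessThan_Suc by (simp add: vdigit_vM)
qed


subsection \<open>The coefficient bound\<close>

text \<open>Integrating against a multiplier measurable at level \<open>K\<close> does not see the
  difference between \<open>f k\<close> and its conditional expectation \<open>f K\<close>.
  Conditional expectation acts on real functions here, so the complex product is expanded into four
  real integrals; the bound on \<open>g\<close> makes all of them exist.\<close>

lemma vmartingale_integral_eq:
  assumes f: "vmartingale m f" and "K \<le> k"
    and g: "g \<in> borel_measurable (vfiltration m K)" and bound: "\<And>x. cmod (g x) \<le> 1"
  shows "(\<integral>x. f k x * g x \<partial>vilenkin m) = (\<integral>x. f K x * g x \<partial>vilenkin m)"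
proof -
  interpret F: finite_measure_subalgebra "vilenkin m" "vfiltration m K"
    by (rule finite_measure_subalgebra_vfiltration)
  have int: "integrable (vilenkin m) (f n)" for n
    using f by (simp add: vmartingale_def)
  then have [measurable]: "f n \<in> borel_measurable (vilenkin m)" for n by auto
  have [measurable]: "g \<in> borel_measurable (vilenkin m)"
    using g by (rule vfiltration_measurable)
  have int_mult: "integrable (vilenkin m) (\<lambda>x. u x * h x)"
    if "u \<in> borel_measurable (vilenkin m)" "\<And>x. \<bar>u x\<bar> \<le> 1" "integrable (vilenkin m) h"
    for u h :: "(nat \<Rightarrow> nat) \<Rightarrow> real"
    by (rule Bochner_Integration.integrable_bound[OF that(3)])
      (use that in \<open>auto simp: abs_mult intro!: mult_left_le_one_le\<close>)
  have AE:
    "AE x in vilenkin m. real_cond_exp (vilenkin m) (vfiltration m K) (\<lambda>y. Re (f k y)) x = Re (f K x)"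
    "AE x in vilenkin m. real_cond_exp (vilenkin m) (vfiltration m K) (\<lambda>y. Im (f k y)) x = Im (f K x)"
    using f \<open>K \<le> k\<close> by (auto simp: vmartingale_def complex_cond_exp_def complex_eq_iff)
  \<comment> \<open>The real multiplier \<open>u\<close> will be the real and then the imaginary
    part of \<open>g\<close>.\<close>
  have eq: "(\<integral>x. u x * Re (f k x) \<partial>vilenkin m) = (\<integral>x. u x * Re (f K x) \<partial>vilenkin m)"
           "(\<integral>x. u x * Im (f k x) \<partial>vilenkin m) = (\<integral>x. u x * Im (f K x) \<partial>vilenkin m)"
    if u: "u \<in> borel_measurable (vfiltration m K)" "\<And>x. \<bar>u x\<bar> \<le> 1" for u
  proof -
    have [measurable]: "u \<in> borel_measurable (vilenkin m)"
      using u(1) by (rule vfiltration_measurable)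
    have "(\<integral>x. u x * real_cond_exp (vilenkin m) (vfiltration m K) (\<lambda>y. h (f k y)) x \<partial>vilenkin m)
        = (\<integral>x. u x * h (f k x) \<partial>vilenkin m)"
      if "h = Re \<or> h = Im" for h
      using u int int_mult[of u "\<lambda>x. h (f k x)"] that
      by (intro F.real_cond_exp_intg) auto
    note this[of Re, symmetric] this[of Im, symmetric]
    moreover have "(\<integral>x. u x * real_cond_exp (vilenkin m) (vfiltration m K) (\<lambda>y. Re (f k y)) x \<partial>vilenkin m)
        = (\<integral>x. u x * Re (f K x) \<partial>vilenkin m)"
      by (rule integral_cong_AE) (use AE(1) in \<open>auto elim!: eventually_mono\<close>)
    moreover have "(\<integral>x. u x * real_cond_exp (vilenkin m) (vfiltration m K) (\<lambda>y. Im (f k y)) x \<partial>vilenkin m)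
        = (\<integral>x. u x * Im (f K x) \<partial>vilenkin m)"
      by (rule integral_cong_AE) (use AE(2) in \<open>auto elim!: eventually_mono\<close>)
    ultimately show "(\<integral>x. u x * Re (f k x) \<partial>vilenkin m) = (\<integral>x. u x * Re (f K x) \<partial>vilenkin m)"
      "(\<integral>x. u x * Im (f k x) \<partial>vilenkin m) = (\<integral>x. u x * Im (f K x) \<partial>vilenkin m)"
      by simp_all
  qed
  have gm: "(\<lambda>x. Re (g x)) \<in> borel_measurable (vfiltration m K)"
           "(\<lambda>x. Im (g x)) \<in> borel_measurable (vfiltration m K)"
    using g by measurable
  have gb: "\<bar>Re (g x)\<bar> \<le> 1" "\<bar>Im (g x)\<bar> \<le> 1" for x
    using bound[of x] abs_Re_le_cmod[of "g x"] abs_Im_le_cmod[of "g x"] by linarith+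
  have im: "integrable (vilenkin m) (\<lambda>x. f n x * g x)" for n
    by (rule Bochner_Integration.integrable_bound[OF int[of n]])
      (use bound in \<open>auto simp: norm_mult intro!: mult_right_le_one_le\<close>)
  have [simp]: "integrable (vilenkin m) (\<lambda>x. Re (g x) * Re (f n x))"
    "integrable (vilenkin m) (\<lambda>x. Re (g x) * Im (f n x))"
    "integrable (vilenkin m) (\<lambda>x. Im (g x) * Re (f n x))"
    "integrable (vilenkin m) (\<lambda>x. Im (g x) * Im (f n x))" for n
    by (intro int_mult gb; use int in simp)+
  have "Re (\<integral>x. f n x * g x \<partial>vilenkin m)
      = (\<integral>x. Re (g x) * Re (f n x) \<partial>vilenkin m) - (\<integral>x. Im (g x) * Im (f n x) \<partial>vilenkin m)"
    "Im (\<integral>x. f n x * g x \<partial>vilenkin m)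
      = (\<integral>x. Re (g x) * Im (f n x) \<partial>vilenkin m) + (\<integral>x. Im (g x) * Re (f n x) \<partial>vilenkin m)" for n
    unfolding integral_Re[OF im, symmetric] integral_Im[OF im, symmetric]
    by (simp_all add: mult.commute[of "Re (f n _)"] mult.commute[of "Im (f n _)"])
  then show ?thesis
    using eq[OF gm(1) gb(1)] eq[OF gm(2) gb(2)] by (simp add: complex_eq_iff)
qed

lemma cnj_vchar_measurable:
  assumes "n < vM m K"
  shows "(\<lambda>x. cnj (vchar m n x)) \<in> borel_measurable (vfiltration m K)"
proof (rule measurable_vfiltrationI)
  fix x y assume "x \<in> space (vilenkin m)" "y \<in> space (vilenkin m)" "\<forall>i<K. x i = y i"
  then have "vchar m n x = vchar m n y"
    by (rule vfiltration_measurable_const[OF vchar_measurable[OF assms]])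
  then show "cnj (vchar m n x) = cnj (vchar m n y)" by (rule arg_cong)
qed

text \<open>The sequence in the defining limit is constant from \<open>K\<close> on, since the
  character is measurable at level \<open>K\<close>.\<close>

lemma vfourier_eq_integral:
  assumes "vmartingale m f" and "i < vM m K"
  shows "vfourier m f i = (\<integral>x. f K x * cnj (vchar m i x) \<partial>vilenkin m)"
proof -
  have "(\<integral>x. f k x * cnj (vchar m i x) \<partial>vilenkin m) = (\<integral>x. f K x * cnj (vchar m i x) \<partial>vilenkin m)"
    if "K \<le> k" for k
    by (rule vmartingale_integral_eq[OF assms(1) that cnj_vchar_measurable[OF assms(2)]])
      (simp add: norm_vchar)
  then have "(\<lambda>k. \<integral>x. f k x * cnj (vchar m i x) \<partial>vilenkin m)
      \<longlonglongrightarrow> (\<integral>x. f K x * cnj (vchar m i x) \<partial>vilenkin m)"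
    by (intro tendsto_eventually eventually_sequentiallyI[of K])
  then show ?thesis unfolding vfourier_def by (rule limI)
qed

lemma norm_le_of_Hp:
  fixes p :: real
  assumes f: "f \<in> Hp m p" and p: "0 < p" "p < 1"
  defines "H \<equiv> enn2real (Hp_norm m p f)"
  shows "(\<integral>x. cmod (f K x) \<partial>vilenkin m) \<le> real (vM m K) powr (1 / p - 1) * H"
proof -
  define A where "A = (\<integral>\<^sup>+x. ennreal_pow (maximal_fun f x) p \<partial>vilenkin m)"
  define a where "a = enn2real A"
  have mart: "vmartingale m f" using f by (simp add: Hp_def)
  have meas: "f K \<in> borel_measurable (vfiltration m K)" and int: "integrable (vilenkin m) (f K)"
    using mart by (auto simp: vmartingale_def)
  have [measurable]: "f K \<in> borel_measurable (vilenkin m)" using int by auto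
  have Hp: "Hp_norm m p f = ennreal_pow A (1 / p)"
    by (simp add: Hp_norm_def Lp_qnorm_def A_def)
  then have "A \<noteq> \<top>" using f by (auto simp: Hp_def ennreal_pow_def)
  then have A: "A = ennreal a" by (simp add: a_def less_top)
  have a0: "a \<ge> 0" by (simp add: a_def)
  have H: "H = a powr (1 / p)"
    unfolding H_def Hp A by (simp add: ennreal_pow_ennreal a0)
  have le_A: "ennreal (cmod (f K x) powr p) \<le> ennreal_pow (maximal_fun f x) p" for x
    unfolding ennreal_pow_ennreal[OF norm_ge_zero, symmetric] maximal_fun_def
    using p by (intro ennreal_pow_mono SUP_upper) auto
  define M where "M = real (vM m K)"
  have M: "M > 0" using vM_pos by (simp add: M_def)
  define S where "S = (M * a) powr (1 / p)"
  \<comment> \<open>\<open>f K\<close> is constant on the interval of level \<open>K\<close> around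
    \<open>x\<close>, which has measure \<open>1 / M\<close>. So
    \<open>cmod (f K x) powr p / M\<close> is part of the integral \<open>A\<close>, whose value is
    \<open>a\<close>.\<close>
  have S: "cmod (f K x) \<le> S" if x: "x \<in> space (vilenkin m)" for x
  proof -
    have "ennreal (cmod (f K x) powr p) * emeasure (vilenkin m) (vinterval m K x)
        = (\<integral>\<^sup>+y. ennreal (cmod (f K x) powr p) * indicator (vinterval m K x) y \<partial>vilenkin m)"
      using sets_vinterval[OF x] by (simp add: nn_integral_cmult_indicator)
    also have "\<dots> \<le> A"
      unfolding A_def
    proof (rule nn_integral_mono)
      fix y assume y: "y \<in> space (vilenkin m)"
      have "f K y = f K x" if "y \<in> vinterval m K x"
        using vfiltration_measurable_const[OF meas y x] that by (simp add: vinterval_def)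
      then show "ennreal (cmod (f K x) powr p) * indicator (vinterval m K x) y
          \<le> ennreal_pow (maximal_fun f y) p"
        using le_A[of y] by (auto split: split_indicator)
    qed
    finally have "ennreal (cmod (f K x) powr p * (1 / M)) \<le> ennreal a"
      by (simp only: emeasure_eq_measure measure_vinterval[OF x] A M_def ennreal_mult' powr_ge_zero)
    then have "cmod (f K x) powr p \<le> M * a"
      using a0 M by (simp add: field_simps)
    then have "(cmod (f K x) powr p) powr (1 / p) \<le> S"
      unfolding S_def using p by (intro powr_mono2) auto
    then show ?thesis using p by (simp add: powr_powr)
  qed
  have intp: "integrable (vilenkin m) (\<lambda>x. cmod (f K x) powr p)"
    by (rule integrable_const_bound[where B = "S powr p"])
      (use S p in \<open>auto intro!: AE_I2 powr_mono2\<close>)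
  have "ennreal (\<integral>x. cmod (f K x) powr p \<partial>vilenkin m) = (\<integral>\<^sup>+x. cmod (f K x) powr p \<partial>vilenkin m)"
    using intp by (intro nn_integral_eq_integral[symmetric]) auto
  also have "\<dots> \<le> A"
    unfolding A_def by (intro nn_integral_mono le_A)
  finally have le_a: "(\<integral>x. cmod (f K x) powr p \<partial>vilenkin m) \<le> a"
    using a0 by (simp add: A)
  \<comment> \<open>Interpolation between the pointwise bound \<open>S\<close> and the integral of
    the \<open>p\<close>-th power: only the factor with exponent \<open>1 - p\<close> is estimated
    pointwise.\<close>
  have "(\<integral>x. cmod (f K x) \<partial>vilenkin m) \<le> (\<integral>x. S powr (1 - p) * cmod (f K x) powr p \<partial>vilenkin m)"
  proof (rule integral_mono)
    show "cmod (f K x) \<le> S powr (1 - p) * cmod (f K x) powr p" if "x \<in> space (vilenkin m)" for x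
    proof -
      have "cmod (f K x) = cmod (f K x) powr (1 - p) * cmod (f K x) powr p"
        by (simp flip: powr_add)
      also have "\<dots> \<le> S powr (1 - p) * cmod (f K x) powr p"
        using S[OF that] p by (intro mult_right_mono powr_mono2) auto
      finally show ?thesis .
    qed
  qed (use int intp in auto)
  also have "\<dots> \<le> S powr (1 - p) * a"
    using le_a by (simp add: mult_left_mono)
  \<comment> \<open>Here \<open>(1 - p) / p = 1 / p - 1\<close>. Writing \<open>a\<close> as
    \<open>a powr 1\<close> lets the two powers of \<open>a\<close> merge into
    \<open>a powr (1 / p)\<close>, which is \<open>H\<close>; this includes
    \<open>a = 0\<close>.\<close>
  also have "\<dots> = M powr (1 / p - 1) * (a powr (1 / p - 1) * a powr 1)"
    using a0 M p by (simp add: S_def powr_powr powr_mult diff_divide_distrib algebra_simps)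
  also have "\<dots> = M powr (1 / p - 1) * H"
    unfolding H powr_add[symmetric] by simp
  finally show ?thesis by (simp add: M_def)
qed

section \<open>Comparing an index with the number base\<close>

lemma vM_sandwich:
  assumes "1 \<le> n"
  obtains N where "vM m N \<le> n" "n < vM m (Suc N)"
proof -
  have "\<exists>N. vM m N \<le> n \<and> n < vM m (Suc N)"
  proof (rule ccontr)
    assume "\<nexists>N. vM m N \<le> n \<and> n < vM m (Suc N)"
    \<comment> \<open>If no \<open>N\<close> works, the bound climbs from each \<open>N\<close> to
      the next, contradicting \<open>n < vM m n\<close>.\<close>
    then have "vM m N \<le> n" for N
      using assms by (induction N) (auto simp: not_less)
    from this[of n] show False using vM_gt[OF ge2, of n] by simp
  qed
  then show ?thesis using that by blast
qed

text \<open>A bound for the ratio of consecutive base numbers, finite because \<open>m\<close> is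
  bounded. Both parts use it to pass between \<open>n\<close> and the neighbouring
  \<open>vM m N\<close>.\<close>

definition digit_bound :: real where "digit_bound = real (SUP k. m k)"

lemma m_le_digit_bound: "real (m k) \<le> digit_bound"
  unfolding digit_bound_def using bdd by (auto intro: cSUP_upper)

lemma digit_bound_pos: "0 < digit_bound"
  using m_le_digit_bound[of 0] m_pos[of 0] by linarith

lemma vM_Suc_le: "real (vM m (Suc N)) \<le> digit_bound * real (vM m N)"
  using m_le_digit_bound[of N] by (simp add: mult_right_mono)

lemma norm_vfourier_le:
  fixes p :: real
  assumes f: "f \<in> Hp m p" and p: "0 < p" "p < 1" and "1 \<le> n"
  shows "cmod (vfourier m f n) \<le>
    digit_bound powr (1 / p - 1) * real n powr (1 / p - 1) * enn2real (Hp_norm m p f)"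
proof -
  \<comment> \<open>The character of index \<open>n\<close> is measurable at level
    \<open>Suc N\<close>, and \<open>vM m (Suc N)\<close> exceeds \<open>n\<close> by at most the
    factor \<open>digit_bound\<close>.\<close>
  obtain N where N: "vM m N \<le> n" "n < vM m (Suc N)"
    using vM_sandwich[OF \<open>1 \<le> n\<close>] .
  have "real (vM m (Suc N)) \<le> digit_bound * real (vM m N)" by (rule vM_Suc_le)
  also have "\<dots> \<le> digit_bound * real n" using N(1) digit_bound_pos by simp
  finally have le: "real (vM m (Suc N)) \<le> digit_bound * real n" .
  have "vfourier m f n = (\<integral>x. f (Suc N) x * cnj (vchar m n x) \<partial>vilenkin m)"
    using f N(2) by (intro vfourier_eq_integral) (auto simp: Hp_def)
  also have "cmod \<dots> \<le> (\<integral>x. cmod (f (Suc N) x * cnj (vchar m n x)) \<partial>vilenkin m)"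
    by (rule integral_norm_bound)
  also have "\<dots> = (\<integral>x. cmod (f (Suc N) x) \<partial>vilenkin m)"
    by (simp add: norm_mult norm_vchar)
  also have "\<dots> \<le> real (vM m (Suc N)) powr (1 / p - 1) * enn2real (Hp_norm m p f)"
    by (rule norm_le_of_Hp[OF f p])
  also have "\<dots> \<le> (digit_bound * real n) powr (1 / p - 1) * enn2real (Hp_norm m p f)"
    using le p by (intro mult_right_mono powr_mono2) (auto simp: field_simps)
  finally show ?thesis using digit_bound_pos by (simp add: powr_mult)
qed


subsection \<open>Lacunary martingales\<close>

text \<open>The closed form of the Dirichlet kernel, the sum of all characters of index below
  \<open>vM m j\<close>: a normalised indicator of the interval at 0.\<close>

definition vdirichlet :: "nat \<Rightarrow> (nat \<Rightarrow> nat) \<Rightarrow> real" where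
  "vdirichlet j x = real (vM m j) * indicator (vinterval m j (\<lambda>_. 0)) x"

lemma sets_vinterval_zero [measurable]: "vinterval m j (\<lambda>_. 0) \<in> sets (vilenkin m)"
  by (intro sets_vinterval zero_in_space)

lemma vdirichlet_measurable: "j \<le> n \<Longrightarrow> vdirichlet j \<in> borel_measurable (vfiltration m n)"
  by (rule measurable_vfiltrationI)
    (auto simp: vdirichlet_def vinterval_def split: split_indicator)

lemma integrable_vdirichlet: "integrable (vilenkin m) (vdirichlet j)"
  unfolding vdirichlet_def
  by (intro integrable_mult_right integrable_real_indicator) (auto simp: less_top[symmetric])

lemma integral_vdirichlet: "(\<integral>x. vdirichlet j x \<partial>vilenkin m) = 1"
  using vM_pos[of j] by (simp add: vdirichlet_def measure_vinterval[OF zero_in_space])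

text \<open>By saturation, \<open>A\<close> either contains or misses the whole interval of level
  \<open>j\<close> at 0, and the kernel has integral 1. The value is the same for every
  \<open>j \<ge> n\<close>, which is the source of the martingale property.\<close>

lemma set_integral_vdirichlet:
  assumes "A \<in> sets (vfiltration m n)" "n \<le> j"
  shows "(\<integral>x\<in>A. vdirichlet j x \<partial>vilenkin m) = indicator A (\<lambda>_. 0)"
proof -
  have "indicator A x *\<^sub>R vdirichlet j x = indicator A (\<lambda>_. 0) * vdirichlet j x"
    if "x \<in> space (vilenkin m)" for x
    using vfiltration_saturated[OF assms(1) that zero_in_space] \<open>n \<le> j\<close>
    by (auto simp: vdirichlet_def vinterval_def split: split_indicator)
  then have "(\<integral>x\<in>A. vdirichlet j x \<partial>vilenkin m)
      = (\<integral>x. indicator A (\<lambda>_. 0) * vdirichlet j x \<partial>vilenkin m)"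
    unfolding set_lebesgue_integral_def by (intro Bochner_Integration.integral_cong) auto
  then show ?thesis by (simp add: integral_vdirichlet)
qed

lemma integral_vdirichlet_rademacher_Suc:
  "(\<integral>x. of_real (vdirichlet (Suc j) x) * cnj (rademacher m j x) \<partial>vilenkin m) = 1"
proof -
  have "of_real (vdirichlet (Suc j) x) * cnj (rademacher m j x) = complex_of_real (vdirichlet (Suc j) x)" for x
    by (auto simp: vdirichlet_def vinterval_def rademacher_def split: split_indicator)
  then show ?thesis by (simp only: integral_complex_of_real integral_vdirichlet of_real_1)
qed

text \<open>For \<open>i \<le> j\<close> the coordinate \<open>j\<close> is free on the interval of
  level \<open>i\<close> at 0. Slicing by its value gives pieces of equal measure, and the integral
  becomes a multiple of a full sum of roots of unity.\<close>

lemma integral_vdirichlet_rademacher_le: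
  assumes "i \<le> j"
  shows "(\<integral>x. of_real (vdirichlet i x) * cnj (rademacher m j x) \<partial>vilenkin m) = 0"
proof -
  \<comment> \<open>\<open>C a\<close> is the slice with coordinate \<open>j\<close> equal to
    \<open>a\<close>. As \<open>j\<close> does not lie in \<open>{..<i}\<close>, the two
    prescriptions never clash.\<close>
  define C where "C a = {y \<in> space (vilenkin m). \<forall>l\<in>insert j {..<i}. y l \<in> (if l = j then {a} else {0})}" for a
  define w where "w a = exp (2 * of_real pi * \<i> * of_nat a / of_nat (m j))" for a
  define \<gamma> where "\<gamma> = (\<Prod>l\<in>insert j {..<i}. 1 / real (m l))"
  have C: "C a \<in> sets (vilenkin m)" "measure (vilenkin m) (C a) = \<gamma>" if "a < m j" for a
  proof -
    show "C a \<in> sets (vilenkin m)"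
      unfolding C_def using that m_pos by (intro cylinder(1)) auto
    have "measure (vilenkin m) (C a)
        = (\<Prod>l\<in>insert j {..<i}. real (card (if l = j then {a} else {0})) / real (m l))"
      unfolding C_def using that m_pos by (intro cylinder(2)) auto
    also have "\<dots> = \<gamma>" unfolding \<gamma>_def by (intro prod.cong) auto
    finally show "measure (vilenkin m) (C a) = \<gamma>" .
  qed
  have "of_real (vdirichlet i x) * cnj (rademacher m j x)
      = (\<Sum>a<m j. of_nat (vM m i) * cnj (w a) * complex_of_real (indicator (C a) x))"
    if x: "x \<in> space (vilenkin m)" for x
  proof -
    have "x \<in> C a \<longleftrightarrow> a = x j \<and> x \<in> vinterval m i (\<lambda>_. 0)" for a
      using x assms by (auto simp: C_def vinterval_def)
    then have "complex_of_real (indicator (C a) x)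
        = (if a = x j then of_real (indicator (vinterval m i (\<lambda>_. 0)) x) else 0)" for a
      by (auto split: split_indicator)
    then have "(\<Sum>a<m j. of_nat (vM m i) * cnj (w a) * complex_of_real (indicator (C a) x))
        = (\<Sum>a<m j. if a = x j then of_nat (vM m i) * cnj (w a) * of_real (indicator (vinterval m i (\<lambda>_. 0)) x) else 0)"
      by (intro sum.cong) auto
    also have "\<dots> = of_nat (vM m i) * cnj (w (x j)) * of_real (indicator (vinterval m i (\<lambda>_. 0)) x)"
      using x by (simp add: mem_space)
    finally show ?thesis by (simp add: vdirichlet_def w_def rademacher_def)
  qed
  then have "(\<integral>x. of_real (vdirichlet i x) * cnj (rademacher m j x) \<partial>vilenkin m)
      = (\<integral>x. (\<Sum>a<m j. of_nat (vM m i) * cnj (w a) * complex_of_real (indicator (C a) x)) \<partial>vilenkin m)"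
    by (intro Bochner_Integration.integral_cong) auto
  also have "\<dots> = (\<Sum>a<m j. of_nat (vM m i) * cnj (w a) * of_real \<gamma>)"
  proof (subst Bochner_Integration.integral_sum)
    fix a assume a: "a \<in> {..<m j}"
    then have "integrable (vilenkin m) (indicator (C a) :: _ \<Rightarrow> real)"
      using C by (intro integrable_real_indicator) (auto simp: less_top[symmetric])
    then show "integrable (vilenkin m) (\<lambda>x. of_nat (vM m i) * cnj (w a) * complex_of_real (indicator (C a) x))"
      by (intro integrable_mult_right integrable_of_real)
  next
    show "(\<Sum>a<m j. \<integral>x. of_nat (vM m i) * cnj (w a) * complex_of_real (indicator (C a) x) \<partial>vilenkin m)
        = (\<Sum>a<m j. of_nat (vM m i) * cnj (w a) * of_real \<gamma>)"
      using C by (intro sum.cong) auto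
  qed
  also have "\<dots> = of_nat (vM m i) * of_real \<gamma> * cnj (\<Sum>a<m j. w a)"
    by (simp add: sum_distrib_left algebra_simps)
  also have "\<dots> = 0"
    unfolding w_def using sum_roots_of_unity[OF spec[OF ge2, of j]] by simp
  finally show ?thesis .
qed

definition lacunary :: "(nat \<Rightarrow> real) \<Rightarrow> nat \<Rightarrow> (nat \<Rightarrow> nat) \<Rightarrow> real" where
  "lacunary c n x = (\<Sum>j<n. c j * (vdirichlet (Suc j) x - vdirichlet j x))"

text \<open>The sum stops below \<open>n\<close>, so the finest kernel in it is that of level
  \<open>n\<close>.\<close>

lemma lacunary_measurable: "lacunary c n \<in> borel_measurable (vfiltration m n)"
  unfolding lacunary_def[abs_def]
  by (intro borel_measurable_sum borel_measurable_times borel_measurable_diff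
      borel_measurable_const vdirichlet_measurable) auto

lemma integrable_lacunary: "integrable (vilenkin m) (lacunary c n)"
  unfolding lacunary_def[abs_def]
  by (intro Bochner_Integration.integrable_sum integrable_mult_right
      Bochner_Integration.integrable_diff integrable_vdirichlet)

text \<open>Each step beyond \<open>n\<close> adds a multiple of a difference of two kernels that
  have the same integral over \<open>A\<close>.\<close>

lemma set_integral_lacunary:
  assumes A: "A \<in> sets (vfiltration m n)" and "n \<le> k"
  shows "(\<integral>x\<in>A. lacunary c k x \<partial>vilenkin m) = (\<integral>x\<in>A. lacunary c n x \<partial>vilenkin m)"
proof -
  have A': "A \<in> sets (vilenkin m)" using A subalgebra_vfiltration by (auto simp: subalgebra_def)
  have si: "set_integrable (vilenkin m) A g" if "integrable (vilenkin m) g" for g :: "_ \<Rightarrow> real"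
    unfolding set_integrable_def using A' that by (rule integrable_mult_indicator)
  show ?thesis using \<open>n \<le> k\<close>
  proof (induction k rule: dec_induct)
    case (step k)
    have "(\<integral>x\<in>A. lacunary c (Suc k) x \<partial>vilenkin m) =
        (\<integral>x\<in>A. lacunary c k x + c k * (vdirichlet (Suc k) x - vdirichlet k x) \<partial>vilenkin m)"
      by (simp add: lacunary_def)
    also have "\<dots> = (\<integral>x\<in>A. lacunary c k x \<partial>vilenkin m)
        + c k * ((\<integral>x\<in>A. vdirichlet (Suc k) x \<partial>vilenkin m) - (\<integral>x\<in>A. vdirichlet k x \<partial>vilenkin m))"
      by (simp add: set_integral_add set_integral_diff si integrable_lacunary integrable_vdirichlet)
    also have "\<dots> = (\<integral>x\<in>A. lacunary c k x \<partial>vilenkin m)"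
      using step.hyps by (simp add: set_integral_vdirichlet[OF A])
    finally show ?case using step.IH by simp
  qed simp
qed

lemma vmartingale_lacunary: "vmartingale m (\<lambda>n x. complex_of_real (lacunary c n x))"
  unfolding vmartingale_def
proof (intro conjI allI impI)
  fix n k :: nat
  show "integrable (vilenkin m) (\<lambda>x. complex_of_real (lacunary c n x))"
    by (intro integrable_of_real integrable_lacunary)
  show "(\<lambda>x. complex_of_real (lacunary c n x)) \<in> borel_measurable (vfiltration m n)"
    using lacunary_measurable by measurable
  assume "n \<le> k"
  interpret F: finite_measure_subalgebra "vilenkin m" "vfiltration m n"
    by (rule finite_measure_subalgebra_vfiltration)
  have "AE x in vilenkin m. real_cond_exp (vilenkin m) (vfiltration m n) (lacunary c k) x = lacunary c n x"
    by (intro F.real_cond_exp_charact set_integral_lacunary integrable_lacunary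
        lacunary_measurable \<open>n \<le> k\<close>)
  moreover have "AE x in vilenkin m. real_cond_exp (vilenkin m) (vfiltration m n) (\<lambda>_. 0) x = 0"
    by (intro F.real_cond_exp_charact) auto
  ultimately show "AE x in vilenkin m.
      complex_cond_exp (vilenkin m) (vfiltration m n) (\<lambda>x. complex_of_real (lacunary c k x)) x =
      complex_of_real (lacunary c n x)"
    by eventually_elim (simp add: complex_cond_exp_def complex_eq_iff)
qed

text \<open>Level \<open>Suc j\<close> suffices to compute this coefficient. Among the kernels of
  level at most \<open>Suc j\<close>, only the last correlates with the \<open>j\<close>-th
  Rademacher function, and it occurs only in the difference weighted by \<open>c j\<close>.\<close>

lemma vfourier_lacunary:
  "vfourier m (\<lambda>n x. complex_of_real (lacunary c n x)) (vM m j) = of_real (c j)"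
proof -
  define I where "I i = (\<integral>x. of_real (vdirichlet i x) * cnj (rademacher m j x) \<partial>vilenkin m)" for i
  have I: "I i = (if i = Suc j then 1 else 0)" if "i \<le> Suc j" for i
    using that integral_vdirichlet_rademacher_Suc[of j] integral_vdirichlet_rademacher_le[of i j]
    by (auto simp: I_def le_Suc_eq)
  have [measurable]: "(\<lambda>x. cnj (rademacher m j x)) \<in> borel_measurable (vilenkin m)"
    unfolding vchar_vM[symmetric]
    by (rule vfiltration_measurable[OF cnj_vchar_measurable[OF vM_less_Suc]])
  have [measurable]: "vdirichlet i \<in> borel_measurable (vilenkin m)" for i
    by (rule borel_measurable_integrable[OF integrable_vdirichlet])
  have [simp]: "integrable (vilenkin m) (\<lambda>x. complex_of_real (vdirichlet i x) * cnj (rademacher m j x))" for i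
    by (rule Bochner_Integration.integrable_bound[OF integrable_vdirichlet[of i]])
      (auto simp: norm_mult norm_vchar[of "vM m j", unfolded vchar_vM])
  have "vfourier m (\<lambda>n x. complex_of_real (lacunary c n x)) (vM m j)
      = (\<integral>x. of_real (lacunary c (Suc j) x) * cnj (rademacher m j x) \<partial>vilenkin m)"
    by (simp add: vfourier_eq_integral[OF vmartingale_lacunary vM_less_Suc] vchar_vM)
  also have "\<dots> = (\<integral>x. (\<Sum>i<Suc j. of_real (c i) *
      (of_real (vdirichlet (Suc i) x) * cnj (rademacher m j x)
        - of_real (vdirichlet i x) * cnj (rademacher m j x))) \<partial>vilenkin m)"
    by (simp only: lacunary_def of_real_sum sum_distrib_right of_real_mult of_real_diff
        mult.assoc left_diff_distrib)
  also have "\<dots> = (\<Sum>i<Suc j. of_real (c i) * (I (Suc i) - I i))"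
    by (simp add: I_def)
  also have "\<dots> = of_real (c j)"
    by (simp add: I)
  finally show ?thesis .
qed

text \<open>Subadditivity of the \<open>p\<close>-th power bounds every partial sum by one function
  \<open>G\<close>, a series of indicators, independently of \<open>n\<close>. Integrating
  \<open>G\<close> term by term gives exactly the series assumed summable.\<close>

lemma lacunary_in_Hp:
  fixes p :: real
  assumes p: "0 < p" "p < 1" and c: "\<And>j. 0 \<le> c j"
    and summable: "summable (\<lambda>j. (c j * real (vM m (Suc j))) powr p / real (vM m j))"
  shows "(\<lambda>n x. complex_of_real (lacunary c n x)) \<in> Hp m p"
proof -
  define d where "d j = (c j * real (vM m (Suc j))) powr p" for j
  define I where "I j = vinterval m j (\<lambda>_. 0)" for j
  define G where "G x = (\<Sum>j. ennreal (d j) * indicator (I j) x)" for x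
  have I [measurable]: "I j \<in> sets (vilenkin m)" for j unfolding I_def by measurable
  have pow_le: "\<bar>lacunary c n x\<bar> powr p \<le> (\<Sum>j<n. d j * indicator (I j) x)" for n x
  proof -
    \<comment> \<open>The difference is \<open>vM m (Suc j) - vM m j\<close> on the smaller
      interval, \<open>- vM m j\<close> on the rest of the larger one, and 0 outside.\<close>
    have "\<bar>vdirichlet (Suc j) x - vdirichlet j x\<bar> \<le> real (vM m (Suc j)) * indicator (I j) x" for j
      using vM_less_Suc[of j]
      by (auto simp: vdirichlet_def I_def vinterval_def less_Suc_eq split: split_indicator)
    then have "\<bar>lacunary c n x\<bar> \<le> (\<Sum>j<n. c j * (real (vM m (Suc j)) * indicator (I j) x))"
      unfolding lacunary_def using c
      by (intro order_trans[OF sum_abs] sum_mono) (auto simp: abs_mult intro!: mult_left_mono)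
    then have "\<bar>lacunary c n x\<bar> powr p \<le> (\<Sum>j<n. c j * (real (vM m (Suc j)) * indicator (I j) x)) powr p"
      using p by (intro powr_mono2) auto
    also have "\<dots> \<le> (\<Sum>j<n. (c j * (real (vM m (Suc j)) * indicator (I j) x)) powr p)"
      using p c by (intro powr_sum_le) auto
    also have "\<dots> = (\<Sum>j<n. d j * indicator (I j) x)"
      unfolding d_def by (intro sum.cong) (auto split: split_indicator)
    finally show ?thesis .
  qed
  have le_G: "ennreal (\<bar>lacunary c n x\<bar> powr p) \<le> G x" for n x
  proof -
    have "ennreal (\<bar>lacunary c n x\<bar> powr p) \<le> ennreal (\<Sum>j<n. d j * indicator (I j) x)"
      using pow_le by (rule ennreal_leI)
    also have "\<dots> = (\<Sum>j<n. ennreal (d j * indicator (I j) x))"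
      by (rule sum_ennreal[symmetric]) (simp add: d_def)
    also have "\<dots> = (\<Sum>j<n. ennreal (d j) * indicator (I j) x)"
      by (intro sum.cong refl) (simp split: split_indicator)
    also have "\<dots> \<le> G x"
      unfolding G_def by (rule sum_le_suminf) auto
    finally show ?thesis .
  qed
  have max_le_G: "ennreal_pow (maximal_fun (\<lambda>n x. complex_of_real (lacunary c n x)) x) p \<le> G x" for x
  \<comment> \<open>\<open>G\<close> may diverge at a point, where the bound is trivial. Elsewhere a
    \<open>p\<close>-th root is taken for each \<open>n\<close> before passing to the
    supremum.\<close>
  proof (cases "G x = \<top>")
    case False
    define g where "g = enn2real (G x)"
    have G: "G x = ennreal g" "g \<ge> 0" using False by (auto simp: g_def less_top)
    have "\<bar>lacunary c n x\<bar> \<le> g powr (1 / p)" for n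
    proof -
      have "\<bar>lacunary c n x\<bar> powr p \<le> g" using le_G[of n x] G by simp
      then have "(\<bar>lacunary c n x\<bar> powr p) powr (1 / p) \<le> g powr (1 / p)"
        using p by (intro powr_mono2) auto
      then show ?thesis using p by (simp add: powr_powr)
    qed
    then have "maximal_fun (\<lambda>n x. complex_of_real (lacunary c n x)) x \<le> ennreal (g powr (1 / p))"
      unfolding maximal_fun_def by (intro SUP_least) (simp add: ennreal_leI)
    then have "ennreal_pow (maximal_fun (\<lambda>n x. complex_of_real (lacunary c n x)) x) p
        \<le> ennreal_pow (ennreal (g powr (1 / p))) p"
      using p by (intro ennreal_pow_mono) auto
    also have "\<dots> = G x" using p G by (simp add: ennreal_pow_ennreal powr_powr)
    finally show ?thesis .
  qed simp
  have "(\<integral>\<^sup>+x. ennreal_pow (maximal_fun (\<lambda>n x. complex_of_real (lacunary c n x)) x) p \<partial>vilenkin m)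
      \<le> (\<integral>\<^sup>+x. G x \<partial>vilenkin m)"
    by (intro nn_integral_mono max_le_G)
  also have "\<dots> = (\<Sum>j. \<integral>\<^sup>+x. ennreal (d j) * indicator (I j) x \<partial>vilenkin m)"
    unfolding G_def by (rule nn_integral_suminf) measurable
  also have "\<dots> = (\<Sum>j. ennreal (d j / real (vM m j)))"
    by (simp add: nn_integral_cmult_indicator emeasure_eq_measure I_def
        measure_vinterval[OF zero_in_space] d_def flip: ennreal_mult')
  also have "\<dots> < \<top>"
    using summable by (subst suminf_ennreal2) (auto simp: d_def)
  finally show ?thesis
    unfolding Hp_def Hp_norm_def Lp_qnorm_def ennreal_pow_def[of _ "1 / p"]
    using vmartingale_lacunary by (auto simp: less_top)
qed

text \<open>Moves the growth from arbitrary indices to base numbers. Replacing \<open>n\<close> by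
  the \<open>vM m j\<close> just below it does not increase \<Phi>, by monotonicity, and costs at
  most \<open>digit_bound powr q\<close> in the power.\<close>

lemma frequently_growth_at_vM:
  fixes q :: real
  assumes q: "0 < q" and mono: "mono_on {1..} \<Phi>" and nonneg: "\<forall>n\<ge>1. 0 \<le> \<Phi> n"
    and lim: "limsup (\<lambda>n. ennreal (real n powr q) / ennreal (\<Phi> n)) = \<infinity>"
    and C: "0 \<le> C"
  shows "\<exists>j\<ge>N. C * \<Phi> (vM m j) < real (vM m j) powr q"
proof -
  \<comment> \<open>Enlarged in advance by the factor lost when \<open>n\<close> is replaced by
    \<open>vM m j\<close>.\<close>
  define C' where "C' = C * digit_bound powr q"
  have "C' \<ge> 0" using C by (simp add: C'_def)
  with lim obtain n where n: "n \<ge> vM m N"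
    and less: "ennreal C' < ennreal (real n powr q) / ennreal (\<Phi> n)"
    unfolding infinity_ennreal_def limsup_eq_top_iff by blast
  have n1: "n \<ge> 1" using n vM_pos[of N] by linarith
  from less have gt: "C' * \<Phi> n < real n powr q"
    using n1 nonneg \<open>C' \<ge> 0\<close> by (subst (asm) ennreal_less_divide_iff) auto
  obtain j where j: "vM m j \<le> n" "n < vM m (Suc j)" using vM_sandwich[OF n1] .
  have "N \<le> j"
  proof (rule ccontr)
    assume "\<not> N \<le> j"
    then have "vM m (Suc j) \<le> vM m N" by (intro vM_mono) simp
    then show False using j n by linarith
  qed
  moreover have "digit_bound powr q * (C * \<Phi> (vM m j)) < digit_bound powr q * real (vM m j) powr q"
  proof -
    have "\<Phi> (vM m j) \<le> \<Phi> n"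
      using mono_onD[OF mono _ _ j(1)] vM_pos[of j] n1 by simp
    then have "digit_bound powr q * (C * \<Phi> (vM m j)) \<le> C' * \<Phi> n"
      using C by (simp add: C'_def mult_left_mono mult.assoc mult.left_commute)
    also have "\<dots> < real n powr q" by (rule gt)
    also have "\<dots> \<le> (digit_bound * real (vM m j)) powr q"
    proof (rule powr_mono2)
      have "real n \<le> real (vM m (Suc j))" using j(2) by (simp only: of_nat_le_iff less_imp_le)
      then show "real n \<le> digit_bound * real (vM m j)" using vM_Suc_le[of j] by (rule order_trans)
    qed (use q in auto)
    finally show ?thesis using digit_bound_pos by (simp add: powr_mult)
  qed
  ultimately show ?thesis using digit_bound_pos by auto
qed

lemma exists_Hp_unbounded_coefficients:
  fixes p :: real
  assumes p: "0 < p" "p < 1" and mono: "mono_on {1..} \<Phi>" and nonneg: "\<forall>n\<ge>1. 0 \<le> \<Phi> n"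
    and lim: "limsup (\<lambda>n. ennreal (real n powr (1 / p - 1)) / ennreal (\<Phi> n)) = \<infinity>"
  shows "\<exists>f\<in>Hp m p. limsup (\<lambda>n. ennreal (cmod (vfourier m f n)) / ennreal (\<Phi> n)) = \<infinity>"
proof -
  define q where "q = 1 / p - 1"
  have q: "0 < q" using p by (simp add: q_def field_simps)
  \<comment> \<open>The factor \<open>4 ^ k\<close> is split later: \<open>2 ^ k\<close> pays for
    the geometric weight of the coefficient, and the other \<open>2 ^ k\<close> makes the quotient
    unbounded.\<close>
  obtain \<alpha> where \<alpha>: "strict_mono \<alpha>"
    and big: "\<And>k. 4 ^ k * \<Phi> (vM m (\<alpha> k)) < real (vM m (\<alpha> k)) powr q"
  proof -
    have "\<exists>j>i. 4 ^ k * \<Phi> (vM m j) < real (vM m j) powr q" for i k :: nat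
      using frequently_growth_at_vM[OF q mono nonneg lim[folded q_def], of "4 ^ k" "Suc i"]
      by (auto simp: Suc_le_eq)
    then have "\<exists>s. \<forall>k i. s k i > i \<and> 4 ^ k * \<Phi> (vM m (s k i)) < real (vM m (s k i)) powr q"
      by (intro choice allI)
    then obtain s where s: "\<And>k i. s k i > i \<and> 4 ^ k * \<Phi> (vM m (s k i)) < real (vM m (s k i)) powr q"
      by blast
    \<comment> \<open>Each new index is chosen beyond the previous one, which yields strict
      monotonicity.\<close>
    define \<alpha> where "\<alpha> = rec_nat (s 0 0) (\<lambda>k. s (Suc k))"
    have \<alpha>_Suc: "\<alpha> (Suc k) = s (Suc k) (\<alpha> k)" for k by (simp add: \<alpha>_def)
    then have "strict_mono \<alpha>" using s by (simp add: strict_mono_Suc_iff)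
    moreover have "4 ^ k * \<Phi> (vM m (\<alpha> k)) < real (vM m (\<alpha> k)) powr q" for k
    proof (cases k)
      case 0
      then show ?thesis using s[of 0 0] by (simp add: \<alpha>_def)
    next
      case (Suc l)
      then show ?thesis using s[of "\<alpha> l" k] \<alpha>_Suc[of l] by simp
    qed
    ultimately show ?thesis by (rule that)
  qed
  \<comment> \<open>The geometric sequence placed along the range of \<alpha> and extended by 0;
    \<alpha> is injective, so \<open>inv \<alpha>\<close> recovers the position.\<close>
  define r where "r j = (if j \<in> range \<alpha> then (1 / 2) ^ inv \<alpha> j else 0 :: real)" for j
  have r_\<alpha>: "r (\<alpha> k) = (1 / 2) ^ k" for k
    using \<alpha> by (simp add: r_def strict_mono_imp_inj_on)
  have r0: "r j \<ge> 0" for j by (simp add: r_def)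
  have "summable (\<lambda>k. r (\<alpha> k) powr p)"
  proof -
    have "r (\<alpha> k) powr p = ((1 / 2) powr p) ^ k" for k
      unfolding r_\<alpha> by (simp add: powr_powr powr_realpow[symmetric] mult.commute)
    moreover have "(1 / 2 :: real) powr p < 1"
      using powr_less_mono2[of p "1 / 2" 1] p by simp
    ultimately show ?thesis by (simp add: summable_geometric)
  qed
  then have summable_r: "summable (\<lambda>j. r j powr p)"
    by (subst (asm) summable_mono_reindex[OF \<alpha>, of "\<lambda>j. r j powr p"]) (auto simp: r_def)
  define c where "c j = r j * real (vM m j) powr q" for j
  define f where "f = (\<lambda>n x. complex_of_real (lacunary c n x))"
  have "f \<in> Hp m p"
    unfolding f_def
  proof (rule lacunary_in_Hp[OF p])
    show "summable (\<lambda>j. (c j * real (vM m (Suc j))) powr p / real (vM m j))"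
    proof (rule summable_comparison_test')
      show "summable (\<lambda>j. digit_bound powr p * r j powr p)"
        by (intro summable_mult summable_r)
      fix j
      define M where "M = real (vM m j)"
      have M: "M > 0" using vM_pos by (simp add: M_def)
      have "(c j * real (vM m (Suc j))) powr p \<le> (c j * (digit_bound * M)) powr p"
        using p vM_Suc_le[of j] r0 unfolding M_def
        by (intro powr_mono2 mult_left_mono) (auto simp: c_def)
      also have "\<dots> = digit_bound powr p * r j powr p * (M powr (q * p) * M powr p)"
        using r0 M digit_bound_pos by (simp add: c_def powr_mult powr_powr M_def)
      \<comment> \<open>Since \<open>q * p = 1 - p\<close>, the powers combine to \<open>M\<close>,
        which cancels the measure factor and leaves a multiple of \<open>r j powr p\<close>.\<close>
      also have "M powr (q * p) * M powr p = M powr 1"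
        unfolding powr_add[symmetric] using p by (simp add: q_def field_simps)
      finally have "(c j * real (vM m (Suc j))) powr p / M \<le> digit_bound powr p * r j powr p"
        using M by (simp add: field_simps)
      then show "norm ((c j * real (vM m (Suc j))) powr p / real (vM m j)) \<le> digit_bound powr p * r j powr p"
        by (simp add: M_def)
    qed
  qed (simp add: c_def r0)
  moreover have "limsup (\<lambda>n. ennreal (cmod (vfourier m f n)) / ennreal (\<Phi> n)) = \<infinity>"
    unfolding infinity_ennreal_def limsup_eq_top_iff
  proof (intro allI impI)
    fix C :: real and N :: nat assume "0 \<le> C"
    obtain k0 where k0: "C < 2 ^ k0" using real_arch_pow[of 2 C] by auto
    \<comment> \<open>\<open>k \<ge> k0\<close> gives \<open>C \<le> 2 ^ k\<close>, and
      \<open>k \<ge> N\<close> gives \<open>n \<ge> N\<close> because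
      \<open>k \<le> \<alpha> k \<le> n\<close>.\<close>
    define k where "k = max N k0"
    define n where "n = vM m (\<alpha> k)"
    have "N \<le> k" by (simp add: k_def)
    also have "k \<le> \<alpha> k" using \<alpha> by (rule strict_mono_imp_increasing)
    also have "\<alpha> k \<le> n" using vM_gt[OF ge2, of "\<alpha> k"] by (simp add: n_def)
    finally have "N \<le> n" .
    have \<Phi>0: "0 \<le> \<Phi> n" using nonneg vM_pos[of "\<alpha> k"] by (simp add: n_def)
    have coeff: "cmod (vfourier m f n) = (1 / 2) ^ k * real n powr q"
      unfolding f_def n_def vfourier_lacunary norm_of_real c_def r_\<alpha> by simp
    have "(2::real) ^ k0 \<le> 2 ^ k" by (rule power_increasing) (simp_all add: k_def)
    with k0 have "C \<le> 2 ^ k" by linarith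
    then have "C * \<Phi> n \<le> 2 ^ k * \<Phi> n" using \<Phi>0 by (rule mult_right_mono)
    also have "\<dots> = (1 / 2) ^ k * (4 ^ k * \<Phi> n)"
      by (simp flip: mult.assoc power_mult_distrib)
    also have "\<dots> < (1 / 2) ^ k * real n powr q"
      using big[of k] by (intro mult_strict_left_mono) (simp_all add: n_def)
    finally have "ennreal C < ennreal (cmod (vfourier m f n)) / ennreal (\<Phi> n)"
      unfolding coeff using \<open>0 \<le> C\<close> \<Phi>0 vM_pos[of "\<alpha> k"]
      by (subst ennreal_less_divide_iff) (auto simp: n_def)
    then show "\<exists>n\<ge>N. ennreal C < ennreal (cmod (vfourier m f n)) / ennreal (\<Phi> n)"
      using \<open>N \<le> n\<close> by blast
  qed
  ultimately show ?thesis by blast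
qed

end

theorem theorem1:
  fixes m :: "nat \<Rightarrow> nat"
  assumes "\<forall>k. 2 \<le> m k" and "bdd_above (range m)"
  shows "(\<forall>p::real. 0 < p \<and> p < 1 \<longrightarrow>
            (\<exists>c::real. \<forall>f\<in>Hp m p. \<forall>n\<ge>1.
               cmod (vfourier m f n) \<le> c * real n powr (1 / p - 1) * enn2real (Hp_norm m p f)))
       \<and> (\<forall>(p::real) (\<Phi> :: nat \<Rightarrow> real).
            0 < p \<and> p < 1 \<and> mono_on {1..} \<Phi> \<and> (\<forall>n\<ge>1. 0 \<le> \<Phi> n) \<and>
            limsup (\<lambda>n. ennreal (real n powr (1 / p - 1)) / ennreal (\<Phi> n)) = \<infinity> \<longrightarrow>
            (\<exists>f0\<in>Hp m p. limsup (\<lambda>n. ennreal (cmod (vfourier m f0 n)) / ennreal (\<Phi> n)) = \<infinity>))"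
proof -
  interpret bounded_vilenkin m
    using assms by unfold_locales
  show ?thesis
  proof (intro conjI allI impI)
    fix p :: real
    assume "0 < p \<and> p < 1"
    \<comment> \<open>The witness is \<open>digit_bound powr (1 / p - 1)\<close>, which depends only
      on \<open>p\<close> and \<open>m\<close>.\<close>
    then show "\<exists>c::real. \<forall>f\<in>Hp m p. \<forall>n\<ge>1.
        cmod (vfourier m f n) \<le> c * real n powr (1 / p - 1) * enn2real (Hp_norm m p f)"
      using norm_vfourier_le by blast
  next
    fix p :: real and \<Phi> :: "nat \<Rightarrow> real"
    assume "0 < p \<and> p < 1 \<and> mono_on {1..} \<Phi> \<and> (\<forall>n\<ge>1. 0 \<le> \<Phi> n) \<and>
      limsup (\<lambda>n. ennreal (real n powr (1 / p - 1)) / ennreal (\<Phi> n)) = \<infinity>"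
    then show "\<exists>f0\<in>Hp m p. limsup (\<lambda>n. ennreal (cmod (vfourier m f0 n)) / ennreal (\<Phi> n)) = \<infinity>"
      using exists_Hp_unbounded_coefficients by blast
  qed
qed

end
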